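(* For every cake-division instance with four agents whose social graph is the line $a_1-a_2-a_3-a_4$, there exists a discrete cake-cutting protocol in the Robertson–Webb query model that finds a locally envy-free allocation using $8$ cut queries and $16$ evaluation queries.
   Context: The cake is $[0,1]$. Each agent $a_i$ has a valuation $v_i$ on finite unions of subintervals of $[0,1]$ that is non-negative, additive on disjoint pieces, non-atomic (for any $[x,y]$ and $\lambda\in[0,1]$ there is $y'$ with $v_i(x,y')=\lambda v_i(x,y)$), and normalized ($v_i(0,1)=1$). An allocation is a collection $\{A_1,\dots,A_4\}$ of pairwise disjoint pieces (each a finite union of intervals) whose union is $[0,1]$, with $A_i$ given to $a_i$. It is locally envy-free on the line if $v_i(A_i)\ge v_i(A_j)$ whenever $|i-j|=1$. In the Robertson–Webb query model the protocol accesses valuations only through cut queries $\texttt{cut}_i(x,\tau)$ (returns $y$ with $v_i(x,y)=\tau$) and evaluation queries $\texttt{eval}_i(x,y)$ (returns $v_i(x,y)$). *)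

theory Defs
  imports Complex_Main
begin

text \<open>A valuation is given by its values on subintervals [x,y] of [0,1]:
  val x y = v([x,y]) for 0 <= x <= y <= 1.  Its value on a finite union of
  intervals (a piece) is the sum over the constituent intervals.\<close>

definition valuation :: "(real \<Rightarrow> real \<Rightarrow> real) \<Rightarrow> bool" where
  "valuation val \<longleftrightarrow>
     (\<forall>x y. 0 \<le> x \<and> x \<le> y \<and> y \<le> 1 \<longrightarrow> 0 \<le> val x y) \<and>
     (\<forall>x y z. 0 \<le> x \<and> x \<le> y \<and> y \<le> z \<and> z \<le> 1 \<longrightarrow> val x z = val x y + val y z) \<and>
     (\<forall>x y lam. 0 \<le> x \<and> x \<le> y \<and> y \<le> 1 \<and> 0 \<le> lam \<and> lam \<le> 1 \<longrightarrow>
        (\<exists>y'. x \<le> y' \<and> y' \<le> y \<and> val x y' = lam * val x y)) \<and>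
     val 0 1 = 1"

text \<open>A piece is a finite union of intervals, given as a list of intervals (a,b) = [a,b].\<close>
type_synonym piece = "(real \<times> real) list"

definition piece_value :: "(real \<Rightarrow> real \<Rightarrow> real) \<Rightarrow> piece \<Rightarrow> real" where
  "piece_value val P = sum_list (map (\<lambda>(a,b). val a b) P)"

definition all_intervals :: "(nat \<Rightarrow> piece) \<Rightarrow> piece" where
  "all_intervals A = concat (map A [1,2,3,4])"

definition is_allocation :: "(nat \<Rightarrow> piece) \<Rightarrow> bool" where
  "is_allocation A \<longleftrightarrow>
     (let I = all_intervals A in
       (\<forall>(a,b) \<in> set I. 0 \<le> a \<and> a \<le> b \<and> b \<le> 1) \<and>
       (\<forall>j k. j < length I \<and> k < length I \<and> j \<noteq> k \<longrightarrow>
          {fst (I!j)<..<snd (I!j)} \<inter> {fst (I!k)<..<snd (I!k)} = {}) \<and>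
       (\<Union>(a,b) \<in> set I. {a..b}) = {0..1})"

definition locally_envy_free_line :: "(nat \<Rightarrow> real \<Rightarrow> real \<Rightarrow> real) \<Rightarrow> (nat \<Rightarrow> piece) \<Rightarrow> bool" where
  "locally_envy_free_line v A \<longleftrightarrow>
     (\<forall>i \<in> {1..4}. \<forall>j \<in> {1..4}. (i + 1 = j \<or> j + 1 = i) \<longrightarrow>
        piece_value (v i) (A i) \<ge> piece_value (v i) (A j))"

text \<open>Robertson--Webb protocols. A (discrete, deterministic) protocol maps the list of
  answers received so far to its next action: a cut query cut_i(x,tau), an evaluation
  query eval_i(x,y), or the output of an allocation.  Arbitrary computation between
  queries is allowed.\<close>

datatype action = Cut nat real real | Eval nat real real | Output "nat \<Rightarrow> piece"

type_synonym protocol = "real list \<Rightarrow> action"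

text \<open>A transcript (answer list) is consistent with valuations v if each answer is a
  legitimate oracle answer to the query the protocol asked at that point.  Cut answers
  are any y in [x,1] with v_i(x,y) = tau (adversarial choice among such y).\<close>

definition consistent :: "(nat \<Rightarrow> real \<Rightarrow> real \<Rightarrow> real) \<Rightarrow> protocol \<Rightarrow> real list \<Rightarrow> bool" where
  "consistent v P as \<longleftrightarrow>
     (\<forall>j < length as. (case P (take j as) of
         Cut i x t \<Rightarrow> x \<le> as!j \<and> as!j \<le> 1 \<and> v i x (as!j) = t
       | Eval i x y \<Rightarrow> as!j = v i x y
       | Output _ \<Rightarrow> False))"

definition is_cut :: "action \<Rightarrow> bool" where
  "is_cut a = (case a of Cut _ _ _ \<Rightarrow> True | _ \<Rightarrow> False)"

definition is_eval :: "action \<Rightarrow> bool" where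
  "is_eval a = (case a of Eval _ _ _ \<Rightarrow> True | _ \<Rightarrow> False)"

definition num_cuts :: "protocol \<Rightarrow> real list \<Rightarrow> nat" where
  "num_cuts P as = card {j. j < length as \<and> is_cut (P (take j as))}"

definition num_evals :: "protocol \<Rightarrow> real list \<Rightarrow> nat" where
  "num_evals P as = card {j. j < length as \<and> is_eval (P (take j as))}"

definition valid_action :: "(nat \<Rightarrow> real \<Rightarrow> real \<Rightarrow> real) \<Rightarrow> action \<Rightarrow> bool" where
  "valid_action v a = (case a of
       Cut i x t \<Rightarrow> i \<in> {1..4} \<and> 0 \<le> x \<and> x \<le> 1 \<and> 0 \<le> t \<and> t \<le> v i x 1
     | Eval i x y \<Rightarrow> i \<in> {1..4} \<and> 0 \<le> x \<and> x \<le> y \<and> y \<le> 1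
     | Output A \<Rightarrow> is_allocation A \<and> locally_envy_free_line v A)"

text \<open>P finds a locally envy-free allocation (line a1-a2-a3-a4) for every instance,
  using at most c cut queries and e evaluation queries on every run.  Since every
  valid query has an answer, bounded query counts force termination with an output.\<close>

definition RW_LEF_line_protocol :: "protocol \<Rightarrow> nat \<Rightarrow> nat \<Rightarrow> bool" where
  "RW_LEF_line_protocol P c e \<longleftrightarrow>
     (\<forall>v. (\<forall>i \<in> {1..4}. valuation (v i)) \<longrightarrow>
        (\<forall>as. consistent v P as \<longrightarrow>
           valid_action v (P as) \<and> num_cuts P as \<le> c \<and> num_evals P as \<le> e))"

end

theory Submission
  imports Defs "HOL-Library.Multiset"
begin

text \<open>
  Agent 2 cuts the cake into quarters, which agent 3 ranks as P1, P2, P3, P4; agent 3 then trims P1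
  into T and R so that T is worth as much as P2.  Agent 2 quarters R as well, and agent 3 ranks
  these quarters as Q1, Q2, Q3, Q4 and cuts Q1 into H and Z so that H is worth as much as Q2 and Z
  together.  Agent 4 picks one of the bundles T, Q2, Z and P2, H, and agent 3 takes the other one;
  agent 1 picks one of the bundles P3, Q3 and P4, Q4, and agent 2 takes the other one.

  Agent 3 is indifferent between the first two bundles and, by the rankings, likes them at least as
  much as the last two.  Agent 2 is indifferent between the last two and does not envy the holder of
  either of the first two: T, Q2, Z lies in P1, and H lies in Q1.
\<close>

section \<open>Protocols as decision trees\<close>

text \<open>A protocol sees the whole answer history. A tree with a continuation for each answer
  lets stages be composed and correctness be proved by structural induction.\<close>

datatype strategy =
    Done "nat \<Rightarrow> piece"
  | Ask_Cut nat real real "real \<Rightarrow> strategy"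
  | Ask_Eval nat real real "real \<Rightarrow> strategy"

primrec run :: "strategy \<Rightarrow> protocol" where
  "run (Done A) = (\<lambda>as. Output A)"
| "run (Ask_Cut i x t k) = (\<lambda>as. case as of [] \<Rightarrow> Cut i x t | a # bs \<Rightarrow> run (k a) bs)"
| "run (Ask_Eval i x y k) = (\<lambda>as. case as of [] \<Rightarrow> Eval i x y | a # bs \<Rightarrow> run (k a) bs)"

text \<open>A weakest precondition: \<open>c\<close> and \<open>e\<close> are the queries still
  allowed, and a cut must succeed for every legal answer. The guards \<open>0 < c\<close> and
  \<open>0 < e\<close> keep the truncated subtraction from granting free queries.\<close>

primrec correct :: "(nat \<Rightarrow> real \<Rightarrow> real \<Rightarrow> real) \<Rightarrow> strategy \<Rightarrow> nat \<Rightarrow> nat \<Rightarrow> bool" where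
  "correct v (Done A) = (\<lambda>c e. is_allocation A \<and> locally_envy_free_line v A)"
| "correct v (Ask_Cut i x t k) = (\<lambda>c e. valid_action v (Cut i x t) \<and> 0 < c \<and>
     (\<forall>y. x \<le> y \<and> y \<le> 1 \<and> v i x y = t \<longrightarrow> correct v (k y) (c - 1) e))"
| "correct v (Ask_Eval i x y k) = (\<lambda>c e. valid_action v (Eval i x y) \<and> 0 < e \<and>
     correct v (k (v i x y)) c (e - 1))"

lemma consistent_Cons:
  "consistent v P (a # as) \<longleftrightarrow>
    (case P [] of Cut i x t \<Rightarrow> x \<le> a \<and> a \<le> 1 \<and> v i x a = t
      | Eval i x y \<Rightarrow> a = v i x y | Output _ \<Rightarrow> False) \<and>
    consistent v (\<lambda>bs. P (a # bs)) as"
  unfolding consistent_def by (simp add: All_less_Suc2 cong: action.case_cong)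

lemma card_less_Suc_shift:
  "card {j. j < Suc n \<and> Q j} = (if Q 0 then 1 else 0) + card {j. j < n \<and> Q (Suc j)}"
proof -
  have "{j. j < Suc n \<and> Q j} = (if Q 0 then {0} else {}) \<union> Suc ` {j. j < n \<and> Q (Suc j)}"
    by (auto simp: image_iff less_Suc_eq_0_disj)
  moreover have "card (Suc ` {j. j < n \<and> Q (Suc j)}) = card {j. j < n \<and> Q (Suc j)}"
    by (simp add: card_image)
  ultimately show ?thesis by (auto simp: card_insert_if)
qed

lemma num_cuts_Cons:
  "num_cuts P (a # as) = (if is_cut (P []) then 1 else 0) + num_cuts (\<lambda>bs. P (a # bs)) as"
  unfolding num_cuts_def by (simp add: card_less_Suc_shift)

lemma num_evals_Cons:
  "num_evals P (a # as) = (if is_eval (P []) then 1 else 0) + num_evals (\<lambda>bs. P (a # bs)) as"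
  unfolding num_evals_def by (simp add: card_less_Suc_shift)

text \<open>The first answer selects a subtree, and the remaining answers form a consistent
  transcript for it. Budgets and transcript vary along a branch, hence the generalised
  induction.\<close>

lemma correct_run:
  assumes "correct v s c e" "consistent v (run s) as"
  shows "valid_action v (run s as) \<and> num_cuts (run s) as \<le> c \<and> num_evals (run s) as \<le> e"
  using assms
proof (induction s arbitrary: c e as)
  case (Done A)
  \<comment> \<open>After an output no further answer is consistent.\<close>
  then have "as = []" by (cases as) (auto simp: consistent_Cons)
  with Done show ?case by (simp add: valid_action_def num_cuts_def num_evals_def)
next
  case (Ask_Cut i x t k)
  show ?case
  proof (cases as)
    case Nil
    with Ask_Cut show ?thesis by (simp add: num_cuts_def num_evals_def)
  next
    case (Cons a bs)
    with Ask_Cut.prems have "correct v (k a) (c - 1) e" "consistent v (run (k a)) bs" "0 < c"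
      by (auto simp: consistent_Cons)
    with Ask_Cut.IH[of "k a" "c - 1" e bs] Cons show ?thesis
      by (auto simp: num_cuts_Cons num_evals_Cons is_cut_def is_eval_def)
  qed
next
  case (Ask_Eval i x y k)
  show ?case
  proof (cases as)
    case Nil
    with Ask_Eval show ?thesis by (simp add: num_cuts_def num_evals_def)
  next
    case (Cons a bs)
    with Ask_Eval.prems have "correct v (k a) c (e - 1)" "consistent v (run (k a)) bs" "0 < e"
      by (auto simp: consistent_Cons)
    with Ask_Eval.IH[of "k a" c "e - 1" bs] Cons show ?thesis
      by (auto simp: num_cuts_Cons num_evals_Cons is_cut_def is_eval_def)
  qed
qed

section \<open>Tilings of the cake\<close>

text \<open>A multiset forgets the order in which the intervals are dealt out to agents. Removing a
  single copy of \<open>I\<close> still compares repeated copies, so only degenerate intervals may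
  occur twice.\<close>

definition tiling :: "(real \<times> real) multiset \<Rightarrow> bool" where
  "tiling M \<longleftrightarrow>
     (\<forall>(a,b) \<in># M. 0 \<le> a \<and> a \<le> b \<and> b \<le> 1) \<and>
     (\<forall>I \<in># M. \<forall>J \<in># M - {#I#}. {fst I<..<snd I} \<inter> {fst J<..<snd J} = {}) \<and>
     (\<Union>(a,b) \<in> set_mset M. {a..b}) = {0..1}"

lemma tiling_unit: "tiling {#(0, 1)#}"
  by (simp add: tiling_def)

lemma tiling_split:
  assumes "tiling (add_mset (a, c) M)" "a \<le> b" "b \<le> c"
  shows "tiling (add_mset (a, b) (add_mset (b, c) M))"
proof -
  define R where "R I J \<longleftrightarrow> {fst I<..<snd I} \<inter> {fst J<..<snd J} = {}" for I J :: "real \<times> real"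
  have R_ac: "\<forall>J \<in># M. R (a, c) J"
    using assms(1) unfolding tiling_def R_def[symmetric] by simp
  have "R (a, b) J \<and> R J (a, b) \<and> R (b, c) J \<and> R J (b, c)" if "J \<in># M" for J
  proof -
    have "R (a, c) J" using R_ac that by blast
    with assms(2,3) show ?thesis unfolding R_def by fastforce
  qed
  moreover have "R (a, b) (b, c)" "R (b, c) (a, b)" by (auto simp: R_def)
  moreover have "{a..c} = {a..b} \<union> {b..c}" using assms by auto
  ultimately show ?thesis
    using assms unfolding tiling_def R_def[symmetric] by (auto simp: Un_assoc)
qed

text \<open>Deleting one copy of the entry at position \<open>j\<close> leaves every other position
  intact, even one holding an equal interval, so disjointness in the multiset gives disjointness by
  index.\<close>

lemma is_allocationI:
  assumes "tiling (mset (all_intervals A))"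
  shows "is_allocation A"
proof -
  let ?I = "all_intervals A"
  have "?I ! k \<in># mset ?I - {#?I ! j#}" if "j < length ?I" "k < length ?I" "j \<noteq> k" for j k
  proof -
    have "mset ?I - {#?I ! j#} = mset (take j ?I @ drop (Suc j) ?I)"
      using that by (subst id_take_nth_drop[of j ?I]) simp_all
    moreover have "?I ! k \<in> set (take j ?I @ drop (Suc j) ?I)"
    proof (cases "k < j")
      case True
      with that have "take j ?I ! k = ?I ! k" "k < length (take j ?I)" by simp_all
      then show ?thesis by (metis Un_iff nth_mem set_append)
    next
      case False
      with that have "drop (Suc j) ?I ! (k - Suc j) = ?I ! k" "k - Suc j < length (drop (Suc j) ?I)"
        by simp_all
      then show ?thesis by (metis Un_iff nth_mem set_append)
    qed
    ultimately show ?thesis by simp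
  qed
  moreover have "?I ! j \<in># mset ?I" if "j < length ?I" for j
    using that by simp
  ultimately have "{fst (?I!j)<..<snd (?I!j)} \<inter> {fst (?I!k)<..<snd (?I!k)} = {}"
    if "j < length ?I" "k < length ?I" "j \<noteq> k" for j k
    using assms that unfolding tiling_def by blast
  with assms show ?thesis
    unfolding tiling_def is_allocation_def Let_def set_mset_mset by blast
qed

section \<open>Valuations\<close>

lemma valuation_nonneg: "valuation u \<Longrightarrow> 0 \<le> x \<Longrightarrow> x \<le> y \<Longrightarrow> y \<le> 1 \<Longrightarrow> 0 \<le> u x y"
  unfolding valuation_def by blast

lemma valuation_add:
  "valuation u \<Longrightarrow> 0 \<le> x \<Longrightarrow> x \<le> y \<Longrightarrow> y \<le> z \<Longrightarrow> z \<le> 1 \<Longrightarrow> u x z = u x y + u y z"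
  unfolding valuation_def by blast

lemma piece_value_simps [simp]:
  "piece_value u [] = 0"
  "piece_value u ((a, b) # P) = u a b + piece_value u P"
  by (simp_all add: piece_value_def)

section \<open>Trimming, choosing and quartering\<close>

text \<open>
  The answer to a cut query may lie beyond b, separated from b by an interval of value 0.
\<close>

definition trim :: "nat \<Rightarrow> real \<Rightarrow> real \<Rightarrow> real \<Rightarrow> (real \<Rightarrow> strategy) \<Rightarrow> strategy" where
  "trim i a b t k = Ask_Cut i a t (\<lambda>y. k (min y b))"

lemma correct_trim:
  assumes "valuation (v i)" "i \<in> {1..4}" "0 \<le> a" "a \<le> b" "b \<le> 1" "0 \<le> t" "t \<le> v i a b"
    and k: "\<And>y. a \<le> y \<Longrightarrow> y \<le> b \<Longrightarrow> v i a y = t \<Longrightarrow> v i y b = v i a b - t \<Longrightarrow> correct v (k y) c e"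
  shows "correct v (trim i a b t k) (Suc c) e"
proof -
  have "v i a b \<le> v i a 1"
    using valuation_add[of "v i" a b 1] valuation_nonneg[of "v i" b 1] assms by auto
  moreover have "correct v (k (min y b)) c e" if y: "a \<le> y" "y \<le> 1" "v i a y = t" for y
  proof -
    have "v i a (min y b) = t"
    proof (cases "y \<le> b")
      \<comment> \<open>Beyond \<open>b\<close>, additivity gives
        \<open>t = v i a y \<ge> v i a b \<ge> t\<close>, so \<open>b\<close> is itself a correct
        cut point.\<close>
      case False
      with y assms valuation_add[of "v i" a b y] valuation_nonneg[of "v i" b y] show ?thesis
        by (auto simp: min_def)
    qed (use y in simp)
    then show ?thesis
      using k[of "min y b"] valuation_add[of "v i" a "min y b" b] y assms by auto
  qed
  ultimately show ?thesis
    using assms by (auto simp: trim_def valid_action_def)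
qed

primrec eval_piece :: "nat \<Rightarrow> piece \<Rightarrow> (real \<Rightarrow> strategy) \<Rightarrow> strategy" where
  "eval_piece i [] = (\<lambda>k. k 0)"
| "eval_piece i (I # P) =
     (\<lambda>k. Ask_Eval i (fst I) (snd I) (\<lambda>x. eval_piece i P (\<lambda>y. k (x + y))))"

lemma correct_eval_piece:
  assumes "i \<in> {1..4}" "\<forall>(a,b) \<in> set P. 0 \<le> a \<and> a \<le> b \<and> b \<le> 1"
    and "correct v (k (piece_value (v i) P)) c e"
  shows "correct v (eval_piece i P k) c (length P + e)"
  using assms(2,3)
proof (induction P arbitrary: k)
  case (Cons I P)
  obtain a b where "I = (a, b)" by fastforce
  with Cons Cons.IH[of "\<lambda>y. k (v i a b + y)"] \<open>i \<in> _\<close> show ?case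
    by (simp add: valid_action_def)
qed simp

definition pick :: "nat \<Rightarrow> piece \<Rightarrow> piece \<Rightarrow> (piece \<Rightarrow> piece \<Rightarrow> strategy) \<Rightarrow> strategy" where
  "pick i B C k =
     eval_piece i B (\<lambda>x. eval_piece i C (\<lambda>y. if y \<le> x then k B C else k C B))"

text \<open>Both outcomes must be handled by the continuation; the cost is one evaluation per
  interval of either bundle.\<close>

lemma correct_pick:
  assumes "i \<in> {1..4}" "\<forall>(a,b) \<in> set (B @ C). 0 \<le> a \<and> a \<le> b \<and> b \<le> 1"
    and "\<And>X Y. (X, Y) \<in> {(B, C), (C, B)} \<Longrightarrow> piece_value (v i) Y \<le> piece_value (v i) X \<Longrightarrow>
      correct v (k X Y) c e"
  shows "correct v (pick i B C k) c (length B + (length C + e))"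
  unfolding pick_def using assms by (intro correct_eval_piece) auto

text \<open>
  The parameter t is a quarter of agent i's value of [a,b], and w is agent j's value of [a,b], which
  saves the evaluation of the last quarter.  The quarters are passed on with their values to
  agent j, in decreasing order.
\<close>

definition rank_quarters ::
  "nat \<Rightarrow> nat \<Rightarrow> real \<Rightarrow> real \<Rightarrow> real \<Rightarrow> real \<Rightarrow> ((real \<times> real \<times> real) list \<Rightarrow> strategy) \<Rightarrow> strategy" where
  "rank_quarters i j a b t w k =
     trim i a b t (\<lambda>x. trim i x b t (\<lambda>y. trim i y b t (\<lambda>z.
       Ask_Eval j a x (\<lambda>p. Ask_Eval j x y (\<lambda>q. Ask_Eval j y z (\<lambda>r.
         k (sort_key (\<lambda>s. - fst s) [(p, a, x), (q, x, y), (r, y, z), (w - p - q - r, z, b)])))))))"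

text \<open>Three cuts of value \<open>t\<close> leave a last interval of value \<open>t\<close>.
  The tiling fact is stated for every remainder \<open>M\<close>, so it serves for the whole cake as
  well as for one interval of a finer tiling.\<close>

lemma correct_rank_quarters:
  assumes val: "valuation (v i)" "valuation (v j)" and ij: "i \<in> {1..4}" "j \<in> {1..4}"
    and ab: "0 \<le> a" "a \<le> b" "b \<le> 1" and t: "v i a b = 4 * t" and w: "v j a b = w"
    and k: "\<And>w1 a1 b1 w2 a2 b2 w3 a3 b3 w4 a4 b4.
      w2 \<le> w1 \<Longrightarrow> w3 \<le> w2 \<Longrightarrow> w4 \<le> w3 \<Longrightarrow>
      \<forall>(w,x,y) \<in> {(w1,a1,b1), (w2,a2,b2), (w3,a3,b3), (w4,a4,b4)}.
        a \<le> x \<and> x \<le> y \<and> y \<le> b \<and> v i x y = t \<and> v j x y = w \<Longrightarrow>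
      (\<And>M. tiling (add_mset (a, b) M) \<Longrightarrow> tiling ({#(a1,b1), (a2,b2), (a3,b3), (a4,b4)#} + M)) \<Longrightarrow>
      correct v (k [(w1,a1,b1), (w2,a2,b2), (w3,a3,b3), (w4,a4,b4)]) c e"
  shows "correct v (rank_quarters i j a b t w k) (3 + c) (3 + e)"
proof -
  have "0 \<le> t" using valuation_nonneg[of "v i" a b] val ab t by simp
  have main: "correct v (k (sort_key (\<lambda>s. - fst s)
      [(v j a x, a, x), (v j x y, x, y), (v j y z, y, z), (w - v j a x - v j x y - v j y z, z, b)])) c e"
    (is "correct v (k (sort_key _ ?L)) c e")
    if x: "a \<le> x" "x \<le> b" "v i a x = t" and y: "x \<le> y" "y \<le> b" "v i x y = t"
      and z: "y \<le> z" "z \<le> b" "v i y z = t" "v i z b = t" for x y z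
  proof -
    have vz: "v j z b = w - v j a x - v j x y - v j y z"
      using valuation_add[of "v j" a x b] valuation_add[of "v j" x y b] valuation_add[of "v j" y z b]
        val ab x y z w by simp
    \<comment> \<open>The sorted order is unknown, so the facts on the four quarters are carried
      over through equality of multisets; the negated key makes the order decreasing.\<close>
    define S where "S = sort_key (\<lambda>s. - fst s) ?L"
    have mset_S: "mset S = mset ?L" by (simp add: S_def)
    then have "length S = 4" using mset_eq_length by fastforce
    then obtain w1 a1 b1 w2 a2 b2 w3 a3 b3 w4 a4 b4
      where S: "S = [(w1,a1,b1), (w2,a2,b2), (w3,a3,b3), (w4,a4,b4)]"
      by (auto simp: length_Suc_conv numeral_eq_Suc)
    have "sorted (map (\<lambda>s. - fst s) S)" by (simp add: S_def)
    then have "w2 \<le> w1" "w3 \<le> w2" "w4 \<le> w3" by (auto simp: S)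
    moreover have "\<forall>(w,x,y) \<in> set S. a \<le> x \<and> x \<le> y \<and> y \<le> b \<and> v i x y = t \<and> v j x y = w"
      unfolding mset_eq_setD[OF mset_S] using x y z vz by auto
    moreover have "tiling ({#(a1,b1), (a2,b2), (a3,b3), (a4,b4)#} + M)"
      if M: "tiling (add_mset (a, b) M)" for M
    proof -
      have "tiling (add_mset (x, b) (add_mset (a, x) M))"
        using tiling_split[OF M x(1,2)] by (simp add: add_mset_commute)
      from tiling_split[OF this y(1,2)]
      have "tiling (add_mset (y, b) (add_mset (x, y) (add_mset (a, x) M)))"
        by (simp add: add_mset_commute)
      from tiling_split[OF this z(1,2)]
      have "tiling (add_mset (y, z) (add_mset (z, b) (add_mset (x, y) (add_mset (a, x) M))))" .
      moreover have "image_mset snd (mset S) = image_mset snd (mset ?L)" by (simp add: mset_S)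
      ultimately show ?thesis by (simp add: S add_mset_commute)
    qed
    ultimately have "correct v (k S) c e"
      unfolding S by (intro k) auto
    then show ?thesis by (simp add: S_def)
  qed
  have "correct v (rank_quarters i j a b t w k) (Suc (Suc (Suc c))) (Suc (Suc (Suc e)))"
    unfolding rank_quarters_def using \<open>0 \<le> t\<close> t ab val ij main
    by (intro correct_trim) (auto simp: valid_action_def)
  then show ?thesis by (simp add: numeral_eq_Suc)
qed

section \<open>The protocol\<close>

definition allocate :: "piece \<Rightarrow> piece \<Rightarrow> piece \<Rightarrow> piece \<Rightarrow> nat \<Rightarrow> piece" where
  "allocate A B C D i = (if i = 1 then A else if i = 2 then B else if i = 3 then C else D)"

lemma is_allocation_allocate:
  "tiling (mset A + mset B + mset C + mset D) \<Longrightarrow> is_allocation (allocate A B C D)"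
  by (rule is_allocationI) (simp add: all_intervals_def allocate_def add.assoc)

lemma locally_envy_free_line_allocate:
  assumes "piece_value (v 1) B \<le> piece_value (v 1) A"
    and "piece_value (v 2) A \<le> piece_value (v 2) B" "piece_value (v 2) C \<le> piece_value (v 2) B"
    and "piece_value (v 3) B \<le> piece_value (v 3) C" "piece_value (v 3) D \<le> piece_value (v 3) C"
    and "piece_value (v 4) C \<le> piece_value (v 4) D"
  shows "locally_envy_free_line v (allocate A B C D)"
proof -
  have "{1..4} = {1, 2, 3, 4::nat}" by auto
  with assms show ?thesis by (simp add: locally_envy_free_line_def allocate_def)
qed

definition divide :: "real \<times> real \<Rightarrow> real \<times> real \<Rightarrow> real \<times> real \<Rightarrow> real \<times> real \<Rightarrow>
    real \<times> real \<Rightarrow> real \<times> real \<Rightarrow> real \<times> real \<Rightarrow> real \<times> real \<Rightarrow> real \<times> real \<Rightarrow> strategy" where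
  "divide T Q2 Z P2 H P3 Q3 P4 Q4 =
     pick 4 [T, Q2, Z] [P2, H] (\<lambda>D C. pick 1 [P3, Q3] [P4, Q4] (\<lambda>A B. Done (allocate A B C D)))"

text \<open>Here \<open>w1 - w2\<close> is agent 3's value of the trimmings \<open>[s,b1]\<close>,
  and \<open>r\<close> is agent 2's. If H has value \<open>h\<close>, then Z has value
  \<open>u1 - h\<close>, and \<open>h = u2 + (u1 - h)\<close> gives
  \<open>h = (u1 + u2) / 2\<close>.\<close>

definition line_strategy :: strategy where
  "line_strategy =
     rank_quarters 2 3 0 1 (1/4) 1 (\<lambda>ps. case ps of [(w1,a1,b1), (w2,p2), (w3,p3), (w4,p4)] \<Rightarrow>
       trim 3 a1 b1 w2 (\<lambda>s. Ask_Eval 2 s b1 (\<lambda>r.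
         rank_quarters 2 3 s b1 (r/4) (w1 - w2) (\<lambda>qs. case qs of [(u1,c1,d1), (u2,q2), (u3,q3), (u4,q4)] \<Rightarrow>
           trim 3 c1 d1 ((u1 + u2) / 2) (\<lambda>z.
             divide (a1,s) q2 (z,d1) p2 (c1,z) p3 q3 p4 q4)))))"

text \<open>Agents 4 and 1 each choose from the pair shared with their only neighbour, so conditions
  are imposed on agents 2 and 3 alone. By \<open>eq\<close>, a bound in \<open>le\<close> against
  one bundle of a pair transfers to the other, which covers all four outcomes.\<close>

lemma correct_divide:
  assumes tiling: "tiling {#T, Q2, Z, P2, H, P3, Q3, P4, Q4#}"
    and eq: "piece_value (v 3) [T, Q2, Z] = piece_value (v 3) [P2, H]"
      "piece_value (v 2) [P3, Q3] = piece_value (v 2) [P4, Q4]"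
    and le: "piece_value (v 3) [P3, Q3] \<le> piece_value (v 3) [P2, H]"
      "piece_value (v 3) [P4, Q4] \<le> piece_value (v 3) [P2, H]"
      "piece_value (v 2) [T, Q2, Z] \<le> piece_value (v 2) [P3, Q3]"
      "piece_value (v 2) [P2, H] \<le> piece_value (v 2) [P3, Q3]"
  shows "correct v (divide T Q2 Z P2 H P3 Q3 P4 Q4) 0 9"
proof -
  have bounds: "\<forall>(a,b) \<in> set [T, Q2, Z, P2, H, P3, Q3, P4, Q4]. 0 \<le> a \<and> a \<le> b \<and> b \<le> 1"
    using tiling unfolding tiling_def by simp
  have final: "correct v (Done (allocate A B C D)) 0 0"
    if CD: "(D, C) \<in> {([T, Q2, Z], [P2, H]), ([P2, H], [T, Q2, Z])}"
      "piece_value (v 4) C \<le> piece_value (v 4) D"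
      and AB: "(A, B) \<in> {([P3, Q3], [P4, Q4]), ([P4, Q4], [P3, Q3])}"
      "piece_value (v 1) B \<le> piece_value (v 1) A" for A B C D
  proof -
    have "mset A + mset B + mset C + mset D = {#T, Q2, Z, P2, H, P3, Q3, P4, Q4#}"
      using CD(1) AB(1) by (auto simp: add_mset_commute)
    with tiling have "is_allocation (allocate A B C D)"
      by (intro is_allocation_allocate) simp
    moreover have "locally_envy_free_line v (allocate A B C D)"
      by (rule locally_envy_free_line_allocate)
        (use CD AB eq le in \<open>auto simp del: piece_value_simps\<close>)
    ultimately show ?thesis by simp
  qed
  \<comment> \<open>One evaluation for each of the nine intervals: 3 + 2 for agent 4 and 2 + 2 for
    agent 1.\<close>
  have "correct v (divide T Q2 Z P2 H P3 Q3 P4 Q4) 0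
      (length [T, Q2, Z] + (length [P2, H] + (length [P3, Q3] + (length [P4, Q4] + 0))))"
    unfolding divide_def using bounds
    by (intro correct_pick final) auto
  then show ?thesis by (simp add: numeral_eq_Suc)
qed

lemma correct_line_strategy:
  assumes v: "\<forall>i \<in> {1..4}. valuation (v i)"
  shows "correct v line_strategy 8 16"
proof -
  have v2: "valuation (v 2)" and v3: "valuation (v 3)" using v by auto
  then have unit: "v 2 0 1 = 1" "v 3 0 1 = 1" by (simp_all add: valuation_def)
  \<comment> \<open>The budgets follow the stages: quartering, trimming P1 and evaluating the
    trimmings, quartering again, then cutting Q1 and making the two choices.\<close>
  have "correct v line_strategy (3 + Suc (3 + Suc 0)) (3 + Suc (3 + 9))"
    unfolding line_strategy_def
  proof (rule correct_rank_quarters; (simp only: list.case prod.case)?)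
    fix w1 a1 b1 w2 a2 b2 w3 a3 b3 w4 a4 b4
    assume w: "w2 \<le> w1" "w3 \<le> w2" "w4 \<le> w3"
      and "\<forall>(w,x,y) \<in> {(w1,a1,b1), (w2,a2,b2), (w3,a3,b3), (w4,a4,b4)}.
        0 \<le> x \<and> x \<le> y \<and> y \<le> 1 \<and> v 2 x y = 1/4 \<and> v 3 x y = w"
      and tile1: "\<And>M. tiling (add_mset (0, 1) M) \<Longrightarrow>
        tiling ({#(a1,b1), (a2,b2), (a3,b3), (a4,b4)#} + M)"
    then have P: "0 \<le> a1" "a1 \<le> b1" "b1 \<le> 1" "0 \<le> a2" "a2 \<le> b2" "b2 \<le> 1"
      and P2: "v 2 a1 b1 = 1/4" "v 2 a2 b2 = 1/4" "v 2 a3 b3 = 1/4" "v 2 a4 b4 = 1/4"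
      and P3: "v 3 a1 b1 = w1" "v 3 a2 b2 = w2" "v 3 a3 b3 = w3" "v 3 a4 b4 = w4"
      by auto
    \<comment> \<open>With \<open>w2 \<le> w1\<close>, this makes \<open>w2\<close> a legal target
      for trimming P1.\<close>
    have "0 \<le> w2" using valuation_nonneg[OF v3, of a2 b2] P P3 by simp
    show "correct v (trim 3 a1 b1 w2 (\<lambda>s. Ask_Eval 2 s b1 (\<lambda>r.
        rank_quarters 2 3 s b1 (r/4) (w1 - w2) (\<lambda>qs. case qs of [(u1,c1,d1), (u2,q2), (u3,q3), (u4,q4)] \<Rightarrow>
          trim 3 c1 d1 ((u1 + u2) / 2) (\<lambda>z.
            divide (a1,s) q2 (z,d1) (a2,b2) (c1,z) (a3,b3) q3 (a4,b4) q4)))))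
        (Suc (3 + Suc 0)) (Suc (3 + 9))"
    proof (rule correct_trim)
      fix s assume s: "a1 \<le> s" "s \<le> b1" "v 3 a1 s = w2" "v 3 s b1 = v 3 a1 b1 - w2"
      have "correct v (rank_quarters 2 3 s b1 (v 2 s b1 / 4) (w1 - w2)
        (\<lambda>qs. case qs of [(u1,c1,d1), (u2,q2), (u3,q3), (u4,q4)] \<Rightarrow>
          trim 3 c1 d1 ((u1 + u2) / 2) (\<lambda>z.
            divide (a1,s) q2 (z,d1) (a2,b2) (c1,z) (a3,b3) q3 (a4,b4) q4))) (3 + Suc 0) (3 + 9)"
      proof (rule correct_rank_quarters; (simp only: list.case prod.case)?)
        fix u1 c1 d1 u2 c2 d2 u3 c3 d3 u4 c4 d4
        assume u: "u2 \<le> u1" "u3 \<le> u2" "u4 \<le> u3"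
          and "\<forall>(w,x,y) \<in> {(u1,c1,d1), (u2,c2,d2), (u3,c3,d3), (u4,c4,d4)}.
            s \<le> x \<and> x \<le> y \<and> y \<le> b1 \<and> v 2 x y = v 2 s b1 / 4 \<and> v 3 x y = w"
          and tile2: "\<And>M. tiling (add_mset (s, b1) M) \<Longrightarrow>
            tiling ({#(c1,d1), (c2,d2), (c3,d3), (c4,d4)#} + M)"
        then have Q: "s \<le> c1" "c1 \<le> d1" "d1 \<le> b1" "s \<le> c2" "c2 \<le> d2" "d2 \<le> b1"
          and Q2: "v 2 c1 d1 = v 2 s b1 / 4" "v 2 c2 d2 = v 2 s b1 / 4"
            "v 2 c3 d3 = v 2 s b1 / 4" "v 2 c4 d4 = v 2 s b1 / 4"
          and Q3: "v 3 c1 d1 = u1" "v 3 c2 d2 = u2" "v 3 c3 d3 = u3" "v 3 c4 d4 = u4"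
          by auto
        have "0 \<le> u2" using valuation_nonneg[OF v3, of c2 d2] P s Q Q3 by simp
        show "correct v (trim 3 c1 d1 ((u1 + u2) / 2) (\<lambda>z.
            divide (a1,s) (c2,d2) (z,d1) (a2,b2) (c1,z) (a3,b3) (c3,d3) (a4,b4) (c4,d4)))
            (Suc 0) 9"
        proof (rule correct_trim)
          fix z assume z: "c1 \<le> z" "z \<le> d1" "v 3 c1 z = (u1 + u2) / 2"
            "v 3 z d1 = v 3 c1 d1 - (u1 + u2) / 2"
          \<comment> \<open>The tiling is refined in the order of the cuts: P1 into T and the
            trimmings, these into quarters, and Q1 into H and Z.\<close>
          have "tiling {#(a1,b1), (a2,b2), (a3,b3), (a4,b4)#}"
            using tile1[of "{#}"] tiling_unit by simp
          then have "tiling (add_mset (a1, b1) {#(a2,b2), (a3,b3), (a4,b4)#})"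
            by (simp add: add_mset_commute)
          from tiling_split[OF this s(1,2)]
          have "tiling (add_mset (s, b1) {#(a1,s), (a2,b2), (a3,b3), (a4,b4)#})"
            by (simp add: add_mset_commute)
          from tile2[OF this]
          have "tiling (add_mset (c1, d1) ({#(c2,d2), (c3,d3), (c4,d4)#} +
              {#(a1,s), (a2,b2), (a3,b3), (a4,b4)#}))"
            by (simp add: add_mset_commute)
          from tiling_split[OF this z(1,2)]
          have tile: "tiling {#(a1,s), (c2,d2), (z,d1), (a2,b2), (c1,z), (a3,b3), (c3,d3), (a4,b4), (c4,d4)#}"
            by (simp add: add_mset_commute)
          have "v 2 c1 d1 = v 2 c1 z + v 2 z d1" "v 2 a1 b1 = v 2 a1 s + v 2 s b1"
            by (rule valuation_add[OF v2]; use z P s Q in linarith)+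
          moreover have "0 \<le> v 2 c1 z" "0 \<le> v 2 z d1"
            by (rule valuation_nonneg[OF v2]; use z P s Q in linarith)+
          ultimately have H2: "v 2 a1 s = 1/4 - v 2 s b1"
            "v 2 c1 z \<le> v 2 s b1 / 4" "v 2 z d1 \<le> v 2 s b1 / 4"
            using P2(1) Q2(1) by auto
          have "0 \<le> v 2 s b1"
            by (rule valuation_nonneg[OF v2]; use P s in linarith)
          \<comment> \<open>Write \<open>x\<close> for \<open>v 2 s b1\<close>. For agent 2, P3 with
            Q3 is worth \<open>1/4 + x/4\<close>; T, Q2, Z are worth at most
            \<open>1/4 - x/2\<close>, and P2, H at most \<open>1/4 + x/4\<close>. For agent 3 the
            first two bundles are both worth \<open>w2 + (u1 + u2) / 2\<close>, at least
            \<open>w3 + u3\<close> and \<open>w4 + u4\<close>.\<close>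
          with tile w u H2 show "correct v
            (divide (a1,s) (c2,d2) (z,d1) (a2,b2) (c1,z) (a3,b3) (c3,d3) (a4,b4) (c4,d4)) 0 9"
            by (intro correct_divide) (auto simp: P2 P3 Q2 Q3 s z field_simps)
        qed (use v3 P s Q Q3 u \<open>0 \<le> u2\<close> in auto)
      qed (use v2 v3 P P3 s in auto)
      then show "correct v (Ask_Eval 2 s b1 (\<lambda>r.
        rank_quarters 2 3 s b1 (r/4) (w1 - w2) (\<lambda>qs. case qs of [(u1,c1,d1), (u2,q2), (u3,q3), (u4,q4)] \<Rightarrow>
          trim 3 c1 d1 ((u1 + u2) / 2) (\<lambda>z.
            divide (a1,s) q2 (z,d1) (a2,b2) (c1,z) (a3,b3) q3 (a4,b4) q4))))
        (3 + Suc 0) (Suc (3 + 9))"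
        using P s by (simp add: valid_action_def)
    qed (use v3 P P3 w \<open>0 \<le> w2\<close> in auto)
  qed (use v2 v3 unit in auto)
  then show ?thesis by simp
qed

theorem theorem5:
  shows "\<exists>P :: protocol. RW_LEF_line_protocol P 8 16"
  unfolding RW_LEF_line_protocol_def
  using correct_run correct_line_strategy by blast

end
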